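(* Let $E$ be a weighted graph and $C$ an equivalence class of the relation $\leftrightharpoons$ on the objects of $\mathbf{RG}(E)$. Fix $(F,\phi)\in C$ and $u\in F^0$, and let $(T_C,\xi_C)$ be the representation graph constructed from $(F,\phi)$ and $u$. If $(G,\psi)\in C$, then there is a morphism $\alpha:(T_C,\xi_C)\to(G,\psi)$ in $\mathbf{RG}(E)$.
   Context: Graphs: a directed graph $E=(E^0,E^1,r,s)$ consists of sets $E^0,E^1$ and maps $r,s:E^1\to E^0$ (range, source). All graphs are row-finite ($s^{-1}(v)$ finite for every vertex $v$). A weighted graph is such a graph $E$ with a map $w:E^1\to\mathbb N=\{1,2,\dots\}$. For $v\in E^0$, $w(v)=\max\{w(e)\mid e\in s^{-1}(v)\}$, and $w(v)=0$ if $v$ is a sink. The directed graph $\hat E$ has $\hat E^0=E^0$, $\hat E^1=\{e_1,\dots,e_{w(e)}\mid e\in E^1\}$, $\hat s(e_i)=s(e)$, $\hat r(e_i)=r(e)$; $\mathrm{tag}(e_i)=i$, $\mathrm{st}(e_i)=e$. Representation graphs: a representation graph of $E$ is a pair $(F,\phi)$, $F$ a directed graph and $\phi=(\phi^0,\phi^1):F\to\hat E$ a homomorphism of directed graphs, such that (1) for any $v\in F^0$ and $1\le i\le w(\phi^0(v))$ there is precisely one $f\in s_F^{-1}(v)$ with $\mathrm{tag}(\phi^1(f))=i$; (2) for any $v\in F^0$ and $e\in r^{-1}(\phi^0(v))$ there is precisely one $f\in r_F^{-1}(v)$ with $\mathrm{st}(\phi^1(f))=e$. Paths: the double graph $G_d$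 of a directed graph $G$ is obtained by adding a reversed edge $g^*$ for each edge $g$ (with $(g^* )^*=g$). $\mathrm{Path}(G)$ is the set of finite paths of $G$ (vertices are paths of length $0$); ${}_u\mathrm{Path}(G)$ is the set of those starting at $u$. $\phi$ induces a map $\phi:\mathrm{Path}(F_d)\to\mathrm{Path}(\hat E_d)$. $F$ is connected if any two vertices are joined by a path in $F_d$. A path in $G_d$ is reduced if it contains no subword $gg^*$ or $g^*g$ with $g\in G^1$. Category: $\mathbf{RG}(E)$ is the category of nonempty connected representation graphs of $E$; a morphism $\alpha:(F,\phi)\to(G,\psi)$ is a homomorphism $\alpha:F\to G$ of directed graphs with $\psi\alpha=\phi$. Write $(F,\phi)\leftrightharpoons(G,\psi)$ if there are $u\in F^0$, $v\in G^0$ with $\phi({}_u\mathrm{Path}(F_d))=\psi({}_v\mathrm{Path}(G_d))$; this is an equivalence relation. Construction of $(T_C,\xi_C)=(T,\xi)$: let $P=\phi({}_u\mathrm{Path}(F_d))_{\mathrm{nb}}$ be the set of reduced paths in $\phi({}_u\mathrm{Path}(F_d))\subseteq\mathrm{Path}(\hat E_d)$. Put $T^0=\{v_p\mid p\in P\}$, $T^1=\{e_p\mid p\in P, p\ne\phi(u)\}$. For $p=x_1\cdots x_n\in P$ of length $n\ge1$ (with $x_1\cdots x_{n-1}:=\phi(u)$ if $n=1$): if $x_n\in\hat E^1$, then $s(e_p)=v_{x_1\cdots x_{n-1}}$, $r(e_p)=v_p$, $\xi^1(e_p)=x_n$; if $x_n\in(\hat E^1)^*$, then $s(e_p)=v_p$,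 $r(e_p)=v_{x_1\cdots x_{n-1}}$, $\xi^1(e_p)=x_n^*$. Further $\xi^0(v_p)$ is the endpoint of $p$ in $\hat E_d$ (so $\xi^0(v_{\phi(u)})=\phi(u)$). This is a nonempty connected representation graph of $E$. *)

theory Defs
  imports "Graph_Theory.Digraph" "Graph_Theory.Arc_Walk"
begin

text \<open>Graphs may be infinite, with loops and parallel edges. The tail of an arc is its source,
  the head its range.\<close>

locale row_finite_digraph = wf_digraph G for G :: "('v, 'e) pre_digraph" +
  assumes row_finite: "v \<in> verts G \<Longrightarrow> finite (out_arcs G v)"

locale weighted_digraph = row_finite_digraph E
  for E :: "('a, 'b) pre_digraph" and w :: "'b \<Rightarrow> nat" +
  assumes weight_pos: "e \<in> arcs E \<Longrightarrow> 1 \<le> w e"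

definition vertex_weight :: "('a, 'b) pre_digraph \<Rightarrow> ('b \<Rightarrow> nat) \<Rightarrow> 'a \<Rightarrow> nat" where
  "vertex_weight E w v = (if out_arcs E v = {} then 0 else Max (w ` out_arcs E v))"

text \<open>The edge \<open>e\<^sub>i\<close> is the pair \<open>(e, i)\<close>, so its structure edge is \<^const>\<open>fst\<close> and its tag
  is \<^const>\<open>snd\<close>.\<close>

definition hat_graph :: "('a, 'b) pre_digraph \<Rightarrow> ('b \<Rightarrow> nat) \<Rightarrow> ('a, 'b \<times> nat) pre_digraph" where
  "hat_graph E w =
     \<lparr> verts = verts E,
       arcs = {(e, i). e \<in> arcs E \<and> 1 \<le> i \<and> i \<le> w e},
       tail = (\<lambda>x. tail E (fst x)),
       head = (\<lambda>x. head E (fst x)) \<rparr>"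

abbreviation structure_edge :: "'b \<times> nat \<Rightarrow> 'b" where
  "structure_edge \<equiv> fst"

abbreviation tag :: "'b \<times> nat \<Rightarrow> nat" where
  "tag \<equiv> snd"

definition graph_hom ::
  "('v, 'e) pre_digraph \<Rightarrow> ('x, 'y) pre_digraph \<Rightarrow> ('v \<Rightarrow> 'x) \<times> ('e \<Rightarrow> 'y) \<Rightarrow> bool" where
  "graph_hom G H \<phi> \<longleftrightarrow>
     (\<forall>v \<in> verts G. fst \<phi> v \<in> verts H) \<and>
     (\<forall>e \<in> arcs G. snd \<phi> e \<in> arcs H \<and>
        tail H (snd \<phi> e) = fst \<phi> (tail G e) \<and>
        head H (snd \<phi> e) = fst \<phi> (head G e))"

datatype 'e darc = Fwd 'e | Rev 'e

fun star :: "'e darc \<Rightarrow> 'e darc" where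
  "star (Fwd e) = Rev e"
| "star (Rev e) = Fwd e"

definition double_graph :: "('v, 'e) pre_digraph \<Rightarrow> ('v, 'e darc) pre_digraph" where
  "double_graph G =
     \<lparr> verts = verts G,
       arcs = Fwd ` arcs G \<union> Rev ` arcs G,
       tail = (\<lambda>d. case d of Fwd e \<Rightarrow> tail G e | Rev e \<Rightarrow> head G e),
       head = (\<lambda>d. case d of Fwd e \<Rightarrow> head G e | Rev e \<Rightarrow> tail G e) \<rparr>"

text \<open>A path is its starting vertex together with its list of edges, so that a vertex \<open>v\<close> is the
  path \<open>(v, [])\<close> of length zero.\<close>

type_synonym ('v, 'e) path = "'v \<times> 'e list"

definition paths_from :: "('v, 'e) pre_digraph \<Rightarrow> 'v \<Rightarrow> ('v, 'e) path set" where
  "paths_from G u = {(u, p) | p. \<exists>v. pre_digraph.awalk G u p v}"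

definition path_end :: "('v, 'e) pre_digraph \<Rightarrow> ('v, 'e) path \<Rightarrow> 'v" where
  "path_end G p = last (pre_digraph.awalk_verts G (fst p) (snd p))"

definition path_image ::
  "('v \<Rightarrow> 'x) \<times> ('e \<Rightarrow> 'y) \<Rightarrow> ('v, 'e darc) path \<Rightarrow> ('x, 'y darc) path" where
  "path_image \<phi> p = (fst \<phi> (fst p), map (map_darc (snd \<phi>)) (snd p))"

definition double_connected :: "('v, 'e) pre_digraph \<Rightarrow> bool" where
  "double_connected G \<longleftrightarrow>
     (\<forall>u \<in> verts G. \<forall>v \<in> verts G. \<exists>p. pre_digraph.awalk (double_graph G) u p v)"

definition reduced :: "('v, 'e darc) path \<Rightarrow> bool" where
  "reduced p \<longleftrightarrow> \<not> (\<exists>xs d ys. snd p = xs @ [d, star d] @ ys)"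

type_synonym ('a, 'b, 'v, 'e) rep_graph =
  "('v, 'e) pre_digraph \<times> ('v \<Rightarrow> 'a) \<times> ('e \<Rightarrow> 'b \<times> nat)"

definition is_rep_graph ::
  "('a, 'b) pre_digraph \<Rightarrow> ('b \<Rightarrow> nat) \<Rightarrow> ('a, 'b, 'v, 'e) rep_graph \<Rightarrow> bool" where
  "is_rep_graph E w = (\<lambda>(F, \<phi>).
     row_finite_digraph F \<and>
     graph_hom F (hat_graph E w) \<phi> \<and>
     (\<forall>v \<in> verts F. \<forall>i. 1 \<le> i \<and> i \<le> vertex_weight E w (fst \<phi> v) \<longrightarrow>
        (\<exists>!f. f \<in> out_arcs F v \<and> tag (snd \<phi> f) = i)) \<and>
     (\<forall>v \<in> verts F. \<forall>e \<in> in_arcs E (fst \<phi> v).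
        (\<exists>!f. f \<in> in_arcs F v \<and> structure_edge (snd \<phi> f) = e)))"

definition RG ::
  "('a, 'b) pre_digraph \<Rightarrow> ('b \<Rightarrow> nat) \<Rightarrow> ('a, 'b, 'v, 'e) rep_graph set" where
  "RG E w = {(F, \<phi>). is_rep_graph E w (F, \<phi>) \<and> verts F \<noteq> {} \<and> double_connected F}"

text \<open>Homomorphisms are total functions of which only the values on the source graph matter, so
  \<open>\<psi> \<circ> \<alpha> = \<phi>\<close> is required on vertices and edges of that graph only.\<close>

definition RG_morphism ::
  "('a, 'b) pre_digraph \<Rightarrow> ('b \<Rightarrow> nat) \<Rightarrow>
   ('a, 'b, 'v, 'e) rep_graph \<Rightarrow> ('a, 'b, 'x, 'y) rep_graph \<Rightarrow>
   ('v \<Rightarrow> 'x) \<times> ('e \<Rightarrow> 'y) \<Rightarrow> bool" where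
  "RG_morphism E w = (\<lambda>(F, \<phi>) (G, \<psi>) \<alpha>.
     (F, \<phi>) \<in> RG E w \<and> (G, \<psi>) \<in> RG E w \<and>
     graph_hom F G \<alpha> \<and>
     (\<forall>v \<in> verts F. fst \<psi> (fst \<alpha> v) = fst \<phi> v) \<and>
     (\<forall>f \<in> arcs F. snd \<psi> (snd \<alpha> f) = snd \<phi> f))"

definition RG_equiv ::
  "('a, 'b) pre_digraph \<Rightarrow> ('b \<Rightarrow> nat) \<Rightarrow>
   (('a, 'b, 'v, 'e) rep_graph \<times> ('a, 'b, 'x, 'y) rep_graph) set" where
  "RG_equiv E w = {((F, \<phi>), (G, \<psi>)).
     (F, \<phi>) \<in> RG E w \<and> (G, \<psi>) \<in> RG E w \<and>
     (\<exists>u \<in> verts F. \<exists>v \<in> verts G.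
        path_image \<phi> ` paths_from (double_graph F) u =
        path_image \<psi> ` paths_from (double_graph G) v)}"

definition reduced_images ::
  "('a, 'b, 'v, 'e) rep_graph \<Rightarrow> 'v \<Rightarrow> ('a, ('b \<times> nat) darc) path set" where
  "reduced_images = (\<lambda>(F, \<phi>) u.
     {p \<in> path_image \<phi> ` paths_from (double_graph F) u. reduced p})"

text \<open>The vertex \<open>v\<^sub>p\<close> and the edge \<open>e\<^sub>p\<close> are both represented by the path \<open>p\<close> itself.\<close>

definition T_graph ::
  "('a, 'b, 'v, 'e) rep_graph \<Rightarrow> 'v \<Rightarrow>
   (('a, ('b \<times> nat) darc) path, ('a, ('b \<times> nat) darc) path) pre_digraph" where
  "T_graph = (\<lambda>(F, \<phi>) u.
     \<lparr> verts = reduced_images (F, \<phi>) u,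
       arcs = reduced_images (F, \<phi>) u - {(fst \<phi> u, [])},
       tail = (\<lambda>p. case last (snd p) of Fwd _ \<Rightarrow> (fst p, butlast (snd p)) | Rev _ \<Rightarrow> p),
       head = (\<lambda>p. case last (snd p) of Fwd _ \<Rightarrow> p | Rev _ \<Rightarrow> (fst p, butlast (snd p))) \<rparr>)"

definition T_map ::
  "('a, 'b) pre_digraph \<Rightarrow> ('b \<Rightarrow> nat) \<Rightarrow>
   (('a, ('b \<times> nat) darc) path \<Rightarrow> 'a) \<times> (('a, ('b \<times> nat) darc) path \<Rightarrow> 'b \<times> nat)" where
  "T_map E w =
     (path_end (double_graph (hat_graph E w)),
      \<lambda>p. case last (snd p) of Fwd x \<Rightarrow> x | Rev x \<Rightarrow> x)"

definition T_rep ::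
  "('a, 'b) pre_digraph \<Rightarrow> ('b \<Rightarrow> nat) \<Rightarrow> ('a, 'b, 'v, 'e) rep_graph \<Rightarrow> 'v \<Rightarrow>
   ('a, 'b, ('a, ('b \<times> nat) darc) path, ('a, ('b \<times> nat) darc) path) rep_graph" where
  "T_rep E w X u = (T_graph X u, T_map E w)"

end

theory Submission
  imports Defs
begin

text \<open>The axioms of a representation graph say that in the double graph the arcs leaving a vertex
  carry distinct labels: the tag for an original arc, the structure edge for a reversed one. Hence
  the homomorphism \<open>\<phi>\<close> of a representation graph \<open>(F, \<phi>)\<close> is injective on the arcs of \<open>F\<^sub>d\<close>
  leaving any given vertex (\<open>is_rep_graph_immersion\<close>), and a path of the image is the image of
  exactly one path from \<open>u\<close> (\<open>lift_unique\<close>). So the vertices of \<open>T\<close> are in bijection with the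
  reduced walks of \<open>F\<^sub>d\<close> from \<open>u\<close>, and \<open>T\<close> is the universal covering of \<open>F\<close> at \<open>u\<close>: sending a
  walk to its endpoint is a homomorphism \<open>T \<rightarrow> F\<close> that is bijective on the arcs leaving a vertex
  and on those entering it (\<open>covering_cover\<close>). The axioms of a representation graph pull back
  along such a map (\<open>is_rep_graph_covering\<close>), and \<open>T\<close> is connected because every walk is reached
  from the empty one through its prefixes. This gives a morphism from \<open>T\<close> to the representation
  graph it is built from (\<open>T_rep_morphism\<close>).

  It remains to replace that graph by any other member \<open>(G, \<psi>)\<close> of the class. The graph \<open>T\<close>
  depends on \<open>(F, \<phi>)\<close> and \<open>u\<close> only through the set of images of the paths from \<open>u\<close>
  (\<open>T_graph_cong\<close>). Unique lifting shows that if two representation graphs have equal such sets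
  at one pair of vertices, then every vertex of the first has a partner in the second
  (\<open>RG_equiv_any_base\<close>). So \<open>G\<close> has a vertex \<open>v\<close> for which the construction from \<open>(G, \<psi>)\<close> and
  \<open>v\<close> gives the very same \<open>T\<close>, and the covering \<open>T \<rightarrow> G\<close> at \<open>v\<close> is the morphism.\<close>

section \<open>Walks in double graphs\<close>

abbreviation dwalk :: "('v, 'e) pre_digraph \<Rightarrow> 'v \<Rightarrow> 'e darc list \<Rightarrow> 'v \<Rightarrow> bool" where
  "dwalk G \<equiv> pre_digraph.awalk (double_graph G)"

lemma star_star [simp]: "star (star d) = d"
  by (cases d) auto

lemma map_darc_star [simp]: "map_darc f (star d) = star (map_darc f d)"
  by (cases d) auto

lemma double_graph_simps [simp]:
  "verts (double_graph G) = verts G"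
  "Fwd e \<in> arcs (double_graph G) \<longleftrightarrow> e \<in> arcs G"
  "Rev e \<in> arcs (double_graph G) \<longleftrightarrow> e \<in> arcs G"
  "tail (double_graph G) (Fwd e) = tail G e"
  "tail (double_graph G) (Rev e) = head G e"
  "head (double_graph G) (Fwd e) = head G e"
  "head (double_graph G) (Rev e) = tail G e"
  by (auto simp: double_graph_def)

lemma star_in_double_graph [simp]:
  "star d \<in> arcs (double_graph G) \<longleftrightarrow> d \<in> arcs (double_graph G)"
  "tail (double_graph G) (star d) = head (double_graph G) d"
  "head (double_graph G) (star d) = tail (double_graph G) d"
  by (cases d; simp)+

text \<open>An arc entering \<open>v\<close> leaves it once reversed, so statements about the arcs leaving a vertex of
  a double graph cover both axioms of a representation graph at once.\<close>

lemma out_arcs_double_graph: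
  "out_arcs (double_graph G) v = Fwd ` out_arcs G v \<union> Rev ` in_arcs G v"
  by (auto simp: double_graph_def)

lemma wf_double_graph:
  assumes "wf_digraph G"
  shows "wf_digraph (double_graph G)"
proof -
  interpret wf_digraph G by fact
  show ?thesis by unfold_locales (auto simp: double_graph_def)
qed

lemma (in wf_digraph) awalk_append_ex:
  "awalk u (p @ q) v \<longleftrightarrow> (\<exists>m. awalk u p m \<and> awalk m q v)"
  by auto

lemma (in wf_digraph) awalk_snoc_iff:
  "awalk u (p @ [d]) v \<longleftrightarrow> awalk u p (tail G d) \<and> d \<in> arcs G \<and> head G d = v"
  by (auto simp: awalk_append_ex awalk_simps simp del: awalk_append_iff)

lemma dwalk_reverse:
  assumes "wf_digraph G" "dwalk G u p v"
  shows "dwalk G v (rev (map star p)) u"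
proof -
  interpret D: wf_digraph "double_graph G" using assms(1) by (rule wf_double_graph)
  show ?thesis using assms(2)
    by (induction p arbitrary: u)
      (auto simp: D.awalk_simps D.awalk_snoc_iff simp del: D.awalk_append_iff)
qed

lemma graph_hom_double_graph:
  assumes "graph_hom G H \<phi>"
  shows "graph_hom (double_graph G) (double_graph H) (fst \<phi>, map_darc (snd \<phi>))"
  using assms by (fastforce simp: graph_hom_def double_graph_def)

lemma graph_hom_awalk:
  assumes "wf_digraph G" "wf_digraph H" "graph_hom G H \<phi>" "pre_digraph.awalk G u p v"
  shows "pre_digraph.awalk H (fst \<phi> u) (map (snd \<phi>) p) (fst \<phi> v)"
proof -
  interpret G: wf_digraph G by fact
  interpret H: wf_digraph H by fact
  show ?thesis using assms(3,4)
    by (induction p arbitrary: u) (auto simp: G.awalk_simps H.awalk_simps graph_hom_def)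
qed

lemma path_end_awalk:
  assumes "wf_digraph G" "pre_digraph.awalk G u p v"
  shows "path_end G (u, p) = v"
proof -
  interpret wf_digraph G by fact
  show ?thesis using assms(2) by (auto simp: path_end_def)
qed

lemma reduced_snoc_iff:
  "reduced (a, q @ [f]) \<longleftrightarrow> reduced (a, q) \<and> (q = [] \<or> f \<noteq> star (last q))"
proof -
  have "(\<exists>xs d ys. q @ [f] = xs @ [d, star d] @ ys) \<longleftrightarrow>
      (\<exists>xs d ys. q = xs @ [d, star d] @ ys) \<or> (q \<noteq> [] \<and> f = star (last q))" (is "?L \<longleftrightarrow> ?R")
  proof
    assume ?L
    then obtain xs d ys where *: "q @ [f] = xs @ [d, star d] @ ys" by blast
    show ?R
    proof (cases ys rule: rev_cases)
      case Nil
      then have "q @ [f] = (xs @ [d]) @ [star d]" using * by simp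
      then have "q = xs @ [d]" "f = star d" unfolding append1_eq_conv by blast+
      then show ?thesis by simp
    next
      case (snoc ys' y)
      then have "q @ [f] = (xs @ [d, star d] @ ys') @ [y]" using * by simp
      then have "q = xs @ [d, star d] @ ys'" unfolding append1_eq_conv by blast
      then show ?thesis by blast
    qed
  next
    assume ?R
    then show ?L
    proof
      assume "q \<noteq> [] \<and> f = star (last q)"
      then have "q @ [f] = butlast q @ [last q, star (last q)] @ []" by simp
      then show ?thesis by blast
    next
      assume "\<exists>xs d ys. q = xs @ [d, star d] @ ys"
      then obtain xs d ys where "q = xs @ [d, star d] @ ys" by blast
      then have "q @ [f] = xs @ [d, star d] @ (ys @ [f])" by simp
      then show ?thesis by blast
    qed
  qed
  then show ?thesis unfolding reduced_def snd_conv by blast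
qed

section \<open>Immersions and unique lifting\<close>

text \<open>Local injectivity is asked of the double graph, that is, separately for the arcs leaving a
  vertex and for those entering it: paths may traverse arcs backwards.\<close>

locale immersion =
  fixes F :: "('v, 'e) pre_digraph" and H :: "('x, 'y) pre_digraph"
    and \<phi> :: "('v \<Rightarrow> 'x) \<times> ('e \<Rightarrow> 'y)"
  assumes wf_F: "wf_digraph F" and wf_H: "wf_digraph H"
    and hom: "graph_hom F H \<phi>"
    and locally_inj: "\<And>z. z \<in> verts F \<Longrightarrow> inj_on (map_darc (snd \<phi>)) (out_arcs (double_graph F) z)"
begin

sublocale D: wf_digraph "double_graph F"
  by (rule wf_double_graph[OF wf_F])

lemma arc_eqI:
  assumes "d \<in> arcs (double_graph F)" "d' \<in> arcs (double_graph F)"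
    and "tail (double_graph F) d = tail (double_graph F) d'"
    and "map_darc (snd \<phi>) d = map_darc (snd \<phi>) d'"
  shows "d = d'"
  using locally_inj[of "tail (double_graph F) d"] assms D.tail_in_verts[OF assms(1)]
  by (auto simp: inj_on_def)

text \<open>The start and the image determine a walk arc by arc, because at each vertex reached only one
  arc has the prescribed image.\<close>

lemma lift_unique:
  assumes "dwalk F u p v" "dwalk F u q z" "map (map_darc (snd \<phi>)) p = map (map_darc (snd \<phi>)) q"
  shows "p = q"
  using assms
proof (induction p arbitrary: u q)
  case (Cons d p)
  then obtain d' q' where q: "q = d' # q'" by (cases q) auto
  with Cons.prems have "d = d'" by (intro arc_eqI) (auto simp: D.awalk_simps)
  with Cons q show ?case by (auto simp: D.awalk_simps)
qed simp

lemma dwalk_image: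
  assumes "dwalk F u p v"
  shows "dwalk H (fst \<phi> u) (map (map_darc (snd \<phi>)) p) (fst \<phi> v)"
  using graph_hom_awalk[OF D.wf_digraph wf_double_graph[OF wf_H] graph_hom_double_graph[OF hom] assms]
  by simp

text \<open>A backtracking \<open>d, star d\<close> in the image comes from arcs \<open>f, g\<close> where \<open>g\<close> and \<open>star f\<close> leave
  the same vertex and have the same image, so local injectivity turns it into a backtracking of
  the walk itself.\<close>

lemma reduced_image_iff:
  assumes "dwalk F u q v"
  shows "reduced (a, map (map_darc (snd \<phi>)) q) \<longleftrightarrow> reduced (b, q)"
proof
  assume "reduced (b, q)"
  show "reduced (a, map (map_darc (snd \<phi>)) q)"
    unfolding reduced_def snd_conv
  proof (intro notI, elim exE)
    fix xs d ys
    assume "map (map_darc (snd \<phi>)) q = xs @ [d, star d] @ ys"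
    then obtain xs' f g ys' where q: "q = xs' @ [f] @ [g] @ ys'"
      and fg: "map_darc (snd \<phi>) f = d" "map_darc (snd \<phi>) g = star d"
      by (auto simp: map_eq_append_conv map_eq_Cons_conv)
    have "g = star f"
      using assms fg unfolding q
      by (intro arc_eqI) (auto simp: D.awalk_append_ex D.awalk_simps simp del: D.awalk_append_iff)
    with q \<open>reduced (b, q)\<close> show False by (auto simp: reduced_def)
  qed
next
  assume "reduced (a, map (map_darc (snd \<phi>)) q)"
  show "reduced (b, q)"
    unfolding reduced_def snd_conv
  proof (intro notI, elim exE)
    fix xs d ys
    assume "q = xs @ [d, star d] @ ys"
    then have "map (map_darc (snd \<phi>)) q = map (map_darc (snd \<phi>)) xs
        @ [map_darc (snd \<phi>) d, star (map_darc (snd \<phi>) d)] @ map (map_darc (snd \<phi>)) ys" by simp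
    with \<open>reduced (a, _)\<close> show False unfolding reduced_def snd_conv by blast
  qed
qed

end

section \<open>Coverings\<close>

text \<open>Bijectivity on the arcs leaving a vertex and on those entering it is what makes the two
  unique-existence axioms of a representation graph transfer from the base to the covering graph.\<close>

definition covering ::
  "('v, 'e) pre_digraph \<Rightarrow> ('x, 'y) pre_digraph \<Rightarrow> ('v \<Rightarrow> 'x) \<times> ('e \<Rightarrow> 'y) \<Rightarrow> bool" where
  "covering T F \<alpha> \<longleftrightarrow> graph_hom T F \<alpha> \<and>
     (\<forall>v \<in> verts T. bij_betw (snd \<alpha>) (out_arcs T v) (out_arcs F (fst \<alpha> v)) \<and>
                    bij_betw (snd \<alpha>) (in_arcs T v) (in_arcs F (fst \<alpha> v)))"

lemma Fwd_Rev_eq_iff: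
  "Fwd ` X \<union> Rev ` Y = Fwd ` X' \<union> Rev ` Y' \<longleftrightarrow> X = X' \<and> Y = Y'"
proof -
  have "Fwd -` (Fwd ` X \<union> Rev ` Y) = X" "Rev -` (Fwd ` X \<union> Rev ` Y) = Y"
    for X Y :: "'a set" by auto
  then show ?thesis by metis
qed

lemma inj_on_map_darc_iff:
  "inj_on (map_darc g) (Fwd ` A \<union> Rev ` B) \<longleftrightarrow> inj_on g A \<and> inj_on g B"
  unfolding inj_on_def by (simp add: ball_Un)

lemma bij_betw_map_darc_iff:
  "bij_betw (map_darc g) (Fwd ` A \<union> Rev ` B) (Fwd ` A' \<union> Rev ` B') \<longleftrightarrow>
   bij_betw g A A' \<and> bij_betw g B B'"
proof -
  have "map_darc g ` (Fwd ` A \<union> Rev ` B) = Fwd ` g ` A \<union> Rev ` g ` B"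
    by (simp add: image_Un image_image)
  then show ?thesis unfolding bij_betw_def by (simp add: inj_on_map_darc_iff Fwd_Rev_eq_iff) blast
qed

lemma bij_betw_ex1:
  assumes "bij_betw g A B"
  shows "(\<exists>!x. x \<in> A \<and> P (g x)) \<longleftrightarrow> (\<exists>!y. y \<in> B \<and> P y)"
  unfolding bij_betw_imp_surj_on[OF assms, symmetric]
  using bij_betw_imp_inj_on[OF assms] unfolding Ex1_def inj_on_def by blast

text \<open>Both axioms count arcs at a vertex by a label that is read off in the base, and a covering
  preserves these counts.\<close>

lemma is_rep_graph_covering:
  assumes "wf_digraph T" "covering T F \<alpha>" "is_rep_graph E w (F, \<phi>)"
    and verts: "\<And>v. v \<in> verts T \<Longrightarrow> fst \<xi> v = fst \<phi> (fst \<alpha> v)"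
    and arcs: "\<And>e. e \<in> arcs T \<Longrightarrow> snd \<xi> e = snd \<phi> (snd \<alpha> e)"
  shows "is_rep_graph E w (T, \<xi>)"
proof -
  interpret T: wf_digraph T by fact
  interpret F: row_finite_digraph F using assms(3) by (simp add: is_rep_graph_def)
  have hom: "graph_hom T F \<alpha>" "graph_hom F (hat_graph E w) \<phi>"
    using assms(2,3) by (auto simp: covering_def is_rep_graph_def)
  have out: "bij_betw (snd \<alpha>) (out_arcs T v) (out_arcs F (fst \<alpha> v))"
    and "in": "bij_betw (snd \<alpha>) (in_arcs T v) (in_arcs F (fst \<alpha> v))"
    and vert: "fst \<alpha> v \<in> verts F" if "v \<in> verts T" for v
    using that assms(2) by (auto simp: covering_def graph_hom_def)
  have "row_finite_digraph T"
    using out vert F.row_finite by unfold_locales (metis bij_betw_finite)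
  moreover have "graph_hom T (hat_graph E w) \<xi>"
    using hom by (auto simp: graph_hom_def verts arcs)
  moreover have "\<exists>!f. f \<in> out_arcs T v \<and> tag (snd \<xi> f) = i"
    if v: "v \<in> verts T" and i: "1 \<le> i" "i \<le> vertex_weight E w (fst \<xi> v)" for v i
  proof -
    have "\<exists>!f. f \<in> out_arcs F (fst \<alpha> v) \<and> tag (snd \<phi> f) = i"
      using assms(3) vert[OF v] i by (simp add: is_rep_graph_def verts[OF v])
    then have "\<exists>!f. f \<in> out_arcs T v \<and> tag (snd \<phi> (snd \<alpha> f)) = i"
      by (simp only: bij_betw_ex1[OF out[OF v], where P = "\<lambda>f. tag (snd \<phi> f) = i"])
    then show ?thesis using arcs by (metis in_out_arcs_conv)
  qed
  moreover have "\<exists>!f. f \<in> in_arcs T v \<and> structure_edge (snd \<xi> f) = e"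
    if v: "v \<in> verts T" and e: "e \<in> in_arcs E (fst \<xi> v)" for v e
  proof -
    have "\<exists>!f. f \<in> in_arcs F (fst \<alpha> v) \<and> structure_edge (snd \<phi> f) = e"
      using assms(3) vert[OF v] e unfolding is_rep_graph_def verts[OF v] by blast
    then have "\<exists>!f. f \<in> in_arcs T v \<and> structure_edge (snd \<phi> (snd \<alpha> f)) = e"
      by (simp only: bij_betw_ex1[OF "in"[OF v], where P = "\<lambda>f. structure_edge (snd \<phi> f) = e"])
    then show ?thesis using arcs by (metis in_in_arcs_conv)
  qed
  ultimately show ?thesis by (simp add: is_rep_graph_def)
qed

section \<open>The graph of reduced path images covers\<close>

locale pointed_immersion = immersion F H \<phi>
  for F :: "('v, 'e) pre_digraph" and H :: "('a, 'b \<times> nat) pre_digraph"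
    and \<phi> :: "('v \<Rightarrow> 'a) \<times> ('e \<Rightarrow> 'b \<times> nat)" +
  fixes u :: 'v
  assumes u_in: "u \<in> verts F"
begin

abbreviation T where "T \<equiv> T_graph (F, \<phi>) u"

text \<open>A reduced image is handled through the walk of \<open>F\<^sub>d\<close> that it is the image of: every vertex of
  \<open>T\<close> is \<open>node q\<close> for a unique reduced walk \<open>q\<close> from \<open>u\<close>, and every arc of \<open>T\<close> is such a vertex
  for a nonempty \<open>q\<close>.\<close>

definition node :: "'e darc list \<Rightarrow> ('a, ('b \<times> nat) darc) path" where
  "node q = path_image \<phi> (u, q)"

definition lift :: "('a, ('b \<times> nat) darc) path \<Rightarrow> 'e darc list" where
  "lift p = (THE q. (\<exists>v. dwalk F u q v) \<and> node q = p)"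

definition cover ::
  "(('a, ('b \<times> nat) darc) path \<Rightarrow> 'v) \<times> (('a, ('b \<times> nat) darc) path \<Rightarrow> 'e)" where
  "cover = (\<lambda>p. path_end (double_graph F) (u, lift p),
            \<lambda>p. case last (lift p) of Fwd g \<Rightarrow> g | Rev g \<Rightarrow> g)"

text \<open>The arc \<open>p\<close> of \<open>T\<close> joins \<open>p\<close> to its longest proper prefix, in the direction dictated by
  the last letter of \<open>p\<close>. Reversing it when that letter is a reversed arc yields an arc of
  \<open>T\<^sub>d\<close> that always leads from the prefix to \<open>p\<close>; this removes the case distinction from the
  arguments below.\<close>

definition step ::
  "('a, ('b \<times> nat) darc) path \<Rightarrow> ('a, ('b \<times> nat) darc) path darc" where
  "step p = map_darc (\<lambda>_. p) (last (snd p))"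

lemma lift_node [simp]: "dwalk F u q v \<Longrightarrow> lift (node q) = q"
  unfolding lift_def by (rule the_equality) (auto simp: node_def path_image_def intro: lift_unique)

lemma cover_node: "dwalk F u q v \<Longrightarrow> fst cover (node q) = v"
  by (simp add: cover_def path_end_awalk[OF D.wf_digraph])

lemma reduced_node: "dwalk F u q v \<Longrightarrow> reduced (node q) \<longleftrightarrow> reduced (u, q)"
  by (simp add: node_def path_image_def reduced_image_iff)

lemma node_inject: "dwalk F u q v \<Longrightarrow> dwalk F u q' v' \<Longrightarrow> node q = node q' \<longleftrightarrow> q = q'"
  by (metis lift_node)

lemma verts_T_iff: "p \<in> verts T \<longleftrightarrow> (\<exists>q v. p = node q \<and> dwalk F u q v \<and> reduced (u, q))"
proof -
  have "verts T = {p \<in> node ` {q. \<exists>v. dwalk F u q v}. reduced p}"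
    by (auto simp: T_graph_def reduced_images_def paths_from_def node_def)
  then show ?thesis by (auto simp: reduced_node)
qed

lemma arcs_T_iff:
  "p \<in> arcs T \<longleftrightarrow> (\<exists>q f v. p = node (q @ [f]) \<and> dwalk F u (q @ [f]) v \<and> reduced (u, q @ [f]))"
proof -
  have "p \<in> arcs T \<longleftrightarrow> (\<exists>q v. p = node q \<and> dwalk F u q v \<and> reduced (u, q)) \<and> p \<noteq> (fst \<phi> u, [])"
    unfolding verts_T_iff[symmetric] by (auto simp: T_graph_def)
  also have "\<dots> \<longleftrightarrow> (\<exists>q v. p = node q \<and> dwalk F u q v \<and> reduced (u, q) \<and> q \<noteq> [])"
    by (auto simp: node_def path_image_def)
  also have "\<dots> \<longleftrightarrow> (\<exists>q f v. p = node (q @ [f]) \<and> dwalk F u (q @ [f]) v \<and> reduced (u, q @ [f]))"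
    by (metis rev_exhaust snoc_eq_iff_butlast)
  finally show ?thesis .
qed

lemma step_ends:
  "tail (double_graph T) (step (node (q @ [f]))) = node q"
  "head (double_graph T) (step (node (q @ [f]))) = node (q @ [f])"
  by (cases f; simp add: T_graph_def step_def node_def path_image_def butlast_append)+

lemma cover_step:
  "dwalk F u (q @ [f]) v \<Longrightarrow> map_darc (snd cover) (step (node (q @ [f]))) = f"
  using lift_node[of "q @ [f]" v]
  by (cases f; simp add: step_def cover_def node_def path_image_def)

lemma step_in_arcs [simp]: "step p \<in> arcs (double_graph T) \<longleftrightarrow> p \<in> arcs T"
  by (cases "last (snd p)") (simp_all add: step_def)

lemma double_arc_cases:
  assumes "t \<in> arcs (double_graph T)"
  obtains p where "p \<in> arcs T" "t = step p \<or> t = star (step p)"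
proof -
  obtain p where "p \<in> arcs T" "t = Fwd p \<or> t = Rev p"
    using assms by (auto simp: double_graph_def)
  then show ?thesis by (intro that[of p]) (cases "last (snd p)"; auto simp: step_def)+
qed

lemma wf_T: "wf_digraph T"
proof
  fix p assume "p \<in> arcs T"
  then obtain q f v where p: "p = node (q @ [f])" "dwalk F u (q @ [f]) v" "reduced (u, q @ [f])"
    by (auto simp: arcs_T_iff)
  have "node (q @ [f]) \<in> verts T" unfolding verts_T_iff using p(2,3) by blast
  moreover have "node q \<in> verts T"
    using p(2,3) unfolding verts_T_iff reduced_snoc_iff D.awalk_snoc_iff by blast
  ultimately show "tail T p \<in> verts T" "head T p \<in> verts T"
    using step_ends[of q f] unfolding p(1)
    by (cases "last (snd (node (q @ [f])))"; simp add: step_def)+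
qed

text \<open>From the vertex of a walk \<open>q\<close> one can go back to its prefix or extend \<open>q\<close> by an arc that
  does not undo its last one.\<close>

lemma out_arcs_T_node:
  assumes q: "dwalk F u q x" "reduced (u, q)"
  shows "out_arcs (double_graph T) (node q) =
    (if q = [] then {} else {star (step (node q))}) \<union>
    (\<lambda>f. step (node (q @ [f]))) ` {f \<in> out_arcs (double_graph F) x. q = [] \<or> f \<noteq> star (last q)}"
    (is "_ = ?R")
proof (intro equalityI subsetI)
  fix t assume t: "t \<in> out_arcs (double_graph T) (node q)"
  then obtain p where p: "p \<in> arcs T" "t = step p \<or> t = star (step p)"
    by (auto elim: double_arc_cases)
  from p(1) obtain r f v where r: "p = node (r @ [f])" "dwalk F u (r @ [f]) v" "reduced (u, r @ [f])"
    by (auto simp: arcs_T_iff)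
  then have r': "dwalk F u r (tail (double_graph F) f)" "f \<in> arcs (double_graph F)"
    by (auto simp: D.awalk_snoc_iff simp del: D.awalk_append_iff)
  from p(2) show "t \<in> ?R"
  proof
    assume "t = step p"
    then have "node r = node q" using t step_ends by (auto simp: r(1))
    then have "r = q" using node_inject r'(1) q(1) by blast
    moreover from this have "tail (double_graph F) f = x"
      using cover_node[OF r'(1)] cover_node[OF q(1)] by simp
    ultimately show ?thesis using \<open>t = step p\<close> r r'(2)
      by (auto simp: reduced_snoc_iff)
  next
    assume "t = star (step p)"
    then have "node (r @ [f]) = node q" using t step_ends by (auto simp: r(1))
    then have "r @ [f] = q" using node_inject r(2) q(1) by blast
    then show ?thesis using \<open>t = star (step p)\<close> r(1) by auto
  qed
next
  fix t assume "t \<in> ?R"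
  then consider "q \<noteq> []" "t = star (step (node q))"
    | f where "f \<in> out_arcs (double_graph F) x" "q = [] \<or> f \<noteq> star (last q)"
        "t = step (node (q @ [f]))"
    by (auto split: if_splits)
  then show "t \<in> out_arcs (double_graph T) (node q)"
  proof cases
    case 1
    then obtain r f where r: "q = r @ [f]" by (metis rev_exhaust)
    have "node q \<in> arcs T" unfolding arcs_T_iff using q unfolding r by blast
    then show ?thesis using 1 step_ends(2)[of r f] by (simp add: r)
  next
    case 2
    then have "dwalk F u (q @ [f]) (head (double_graph F) f)" "reduced (u, q @ [f])"
      using q by (auto simp: D.awalk_snoc_iff reduced_snoc_iff simp del: D.awalk_append_iff)
    then have "node (q @ [f]) \<in> arcs T" unfolding arcs_T_iff by blast
    then show ?thesis using 2 step_ends(1)[of q f] by simp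
  qed
qed

text \<open>Going back to the prefix covers \<open>star (last q)\<close>, and the extensions cover exactly the other
  arcs leaving the endpoint \<open>x\<close> of \<open>q\<close>: the only arc that a reduced walk may not continue with is
  the one that the step back accounts for.\<close>

lemma cover_bij:
  assumes q: "dwalk F u q x" "reduced (u, q)"
  shows "bij_betw (map_darc (snd cover)) (out_arcs (double_graph T) (node q))
    (out_arcs (double_graph F) x)"
proof -
  let ?A = "{f \<in> out_arcs (double_graph F) x. q = [] \<or> f \<noteq> star (last q)}"
  let ?c = "map_darc (snd cover)"
  have ext: "?c (step (node (q @ [f]))) = f" if "f \<in> ?A" for f
    using that q by (intro cover_step) (auto simp: D.awalk_snoc_iff simp del: D.awalk_append_iff)
  have turn: "?c (star (step (node q))) = star (last q)" if "q \<noteq> []"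
    using that q(1) cover_step by (cases q rule: rev_cases) auto
  have turn_in: "star (last q) \<in> out_arcs (double_graph F) x" if "q \<noteq> []"
    using that q(1)
    by (cases q rule: rev_cases) (auto simp: D.awalk_snoc_iff simp del: D.awalk_append_iff)
  have inj: "inj_on ?c (out_arcs (double_graph T) (node q))"
    unfolding out_arcs_T_node[OF q] by (rule inj_onI) (use ext turn in \<open>auto split: if_splits\<close>)
  have "?c ` (\<lambda>f. step (node (q @ [f]))) ` ?A = ?A"
    using ext by (force simp: image_iff)
  moreover have "?c ` (if q = [] then {} else {star (step (node q))}) =
      (if q = [] then {} else {star (last q)})"
    using turn by simp
  ultimately have "?c ` out_arcs (double_graph T) (node q) =
      (if q = [] then {} else {star (last q)}) \<union> ?A"
    unfolding out_arcs_T_node[OF q] image_Un by (simp only:)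
  also have "\<dots> = out_arcs (double_graph F) x"
  proof (cases "q = []")
    case False
    show ?thesis using turn_in[OF False] unfolding if_not_P[OF False] by blast
  qed auto
  finally have "?c ` out_arcs (double_graph T) (node q) = out_arcs (double_graph F) x" .
  with inj show ?thesis by (simp add: bij_betw_def)
qed

lemma cover_hom: "graph_hom T F cover"
  unfolding graph_hom_def
proof (intro conjI ballI)
  fix p assume "p \<in> verts T"
  then show "fst cover p \<in> verts F"
    using D.awalk_last_in_verts by (fastforce simp: verts_T_iff cover_node)
next
  fix p assume "p \<in> arcs T"
  then obtain q f v where p: "p = node (q @ [f])" "dwalk F u (q @ [f]) v" "reduced (u, q @ [f])"
    by (auto simp: arcs_T_iff)
  then have q: "dwalk F u q (tail (double_graph F) f)" "f \<in> arcs (double_graph F)"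
      "head (double_graph F) f = v"
    by (auto simp: D.awalk_snoc_iff simp del: D.awalk_append_iff)
  have ends: "fst cover (node q) = tail (double_graph F) f"
      "fst cover p = head (double_graph F) f"
    using cover_node[OF q(1)] cover_node[OF p(2)] q(3) p(1) by auto
  have f: "map_darc (snd cover) (step p) = f" using cover_step[OF p(2)] p(1) by simp
  have t: "tail (double_graph T) (step p) = node q" "head (double_graph T) (step p) = p"
    using step_ends[of q f] p(1) by auto
  have "snd cover p \<in> arcs F \<and> tail F (snd cover p) = fst cover (tail T p)
      \<and> head F (snd cover p) = fst cover (head T p)"
    using ends f t q(2) by (cases "last (snd p)") (auto simp: step_def)
  then show "snd cover p \<in> arcs F" "tail F (snd cover p) = fst cover (tail T p)"
    "head F (snd cover p) = fst cover (head T p)" by auto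
qed

lemma covering_cover: "covering T F cover"
  unfolding covering_def
proof (intro conjI[OF cover_hom] ballI)
  fix p assume "p \<in> verts T"
  then obtain q v where "p = node q" "dwalk F u q v" "reduced (u, q)"
    by (auto simp: verts_T_iff)
  with cover_bij[of q v] cover_node[of q v]
  show "bij_betw (snd cover) (out_arcs T p) (out_arcs F (fst cover p)) \<and>
        bij_betw (snd cover) (in_arcs T p) (in_arcs F (fst cover p))"
    by (simp add: out_arcs_double_graph bij_betw_map_darc_iff)
qed

lemma path_end_cover:
  assumes "p \<in> verts T"
  shows "path_end (double_graph H) p = fst \<phi> (fst cover p)"
proof -
  obtain q v where q: "p = node q" "dwalk F u q v" using assms by (auto simp: verts_T_iff)
  then show ?thesis
    using path_end_awalk[OF wf_double_graph[OF wf_H] dwalk_image[OF q(2)]] cover_node[OF q(2)]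
    by (simp add: node_def path_image_def)
qed

lemma last_arc_cover:
  assumes "p \<in> arcs T"
  shows "(case last (snd p) of Fwd x \<Rightarrow> x | Rev x \<Rightarrow> x) = snd \<phi> (snd cover p)"
proof -
  obtain q f v where q: "p = node (q @ [f])" "dwalk F u (q @ [f]) v"
    using assms by (auto simp: arcs_T_iff)
  then have "lift p = q @ [f]" using lift_node by blast
  then show ?thesis using q(1) by (cases f) (simp_all add: cover_def node_def path_image_def)
qed

lemma root_in_T: "node [] \<in> verts T"
  unfolding verts_T_iff using u_in
  by (intro exI[of _ "[]"] exI[of _ u]) (simp add: D.awalk_Nil_iff reduced_def)

text \<open>The prefixes of a reduced walk are reduced, so they form a walk in \<open>T\<^sub>d\<close> from the root.\<close>

lemma connected_T: "double_connected T"
proof -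
  interpret DT: wf_digraph "double_graph T" by (rule wf_double_graph[OF wf_T])
  have from_root: "\<exists>t. dwalk T (node []) t (node q)" if "dwalk F u q v" "reduced (u, q)" for q v
    using that
  proof (induction q arbitrary: v rule: rev_induct)
    case Nil
    then show ?case using root_in_T by (intro exI[of _ "[]"]) (simp add: DT.awalk_Nil_iff)
  next
    case (snoc f q)
    then have "dwalk F u q (tail (double_graph F) f)" "reduced (u, q)"
      by (auto simp: D.awalk_snoc_iff reduced_snoc_iff simp del: D.awalk_append_iff)
    with snoc.IH obtain t where t: "dwalk T (node []) t (node q)" by blast
    have "node (q @ [f]) \<in> arcs T" unfolding arcs_T_iff using snoc.prems by blast
    with t have "dwalk T (node []) (t @ [step (node (q @ [f]))]) (node (q @ [f]))"
      by (simp add: DT.awalk_snoc_iff step_ends del: DT.awalk_append_iff)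
    then show ?case by blast
  qed
  show ?thesis
    unfolding double_connected_def
  proof (intro ballI)
    fix p p' assume "p \<in> verts T" "p' \<in> verts T"
    then obtain t t' where t: "dwalk T (node []) t p" and t': "dwalk T (node []) t' p'"
      using from_root unfolding verts_T_iff by blast
    from DT.awalk_appendI[OF dwalk_reverse[OF wf_T t] t']
    show "\<exists>p''. dwalk T p p'' p'" by blast
  qed
qed

end

section \<open>Representation graphs\<close>

lemma wf_hat_graph:
  assumes "wf_digraph E"
  shows "wf_digraph (hat_graph E w)"
proof -
  interpret wf_digraph E by fact
  show ?thesis by unfold_locales (auto simp: hat_graph_def)
qed

lemma inj_on_if_unique_label:
  assumes "\<And>x. x \<in> A \<Longrightarrow> \<exists>!y. y \<in> A \<and> l (g y) = l (g x)"
  shows "inj_on g A"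
proof (rule inj_onI)
  fix x y assume xy: "x \<in> A" "y \<in> A" "g x = g y"
  then obtain z where "\<And>y. y \<in> A \<and> l (g y) = l (g x) \<Longrightarrow> y = z"
    using assms[OF xy(1)] by blast
  from this[of x] this[of y] xy show "x = y" by simp
qed

text \<open>Equal images have equal tags and structure edges, which the axioms allow only once at a
  vertex. The uniqueness axiom for tags is limited to tags up to the weight of the vertex. Row
  finiteness of \<open>E\<close> is what makes this limit a genuine maximum, so that the tag of every arc
  leaving the vertex stays within it.\<close>

lemma is_rep_graph_immersion:
  assumes "weighted_digraph E w" "is_rep_graph E w (F, \<phi>)"
  shows "immersion F (hat_graph E w) \<phi>"
proof -
  interpret E: weighted_digraph E w by fact
  interpret F: row_finite_digraph F using assms(2) by (simp add: is_rep_graph_def)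
  have hom: "graph_hom F (hat_graph E w) \<phi>" using assms(2) by (simp add: is_rep_graph_def)
  have tag_bound: "1 \<le> tag (snd \<phi> f) \<and> tag (snd \<phi> f) \<le> vertex_weight E w (fst \<phi> z)"
    if "f \<in> out_arcs F z" for f z
  proof -
    let ?e = "structure_edge (snd \<phi> f)"
    have e: "?e \<in> out_arcs E (fst \<phi> z)" "1 \<le> tag (snd \<phi> f)" "tag (snd \<phi> f) \<le> w ?e"
      using that hom by (auto simp: graph_hom_def hat_graph_def split_beta)
    then have "fst \<phi> z \<in> verts E" using E.tail_in_verts[of ?e] by auto
    then have "finite (out_arcs E (fst \<phi> z))" by (rule E.row_finite)
    then have "w ?e \<le> vertex_weight E w (fst \<phi> z)"
      using e(1) by (auto simp: vertex_weight_def)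
    with e show ?thesis by simp
  qed
  have edge_in: "structure_edge (snd \<phi> f) \<in> in_arcs E (fst \<phi> z)" if "f \<in> in_arcs F z" for f z
    using that hom by (auto simp: graph_hom_def hat_graph_def split_beta)
  have "inj_on (map_darc (snd \<phi>)) (out_arcs (double_graph F) z)" if z: "z \<in> verts F" for z
  proof -
    have "inj_on (snd \<phi>) (out_arcs F z)"
      using assms(2) z tag_bound unfolding is_rep_graph_def
      by (intro inj_on_if_unique_label[where l = tag]) blast
    moreover have "inj_on (snd \<phi>) (in_arcs F z)"
      using assms(2) z edge_in unfolding is_rep_graph_def
      by (intro inj_on_if_unique_label[where l = structure_edge]) blast
    ultimately show ?thesis
      by (simp only: out_arcs_double_graph inj_on_map_darc_iff)
  qed
  then show ?thesis
    by (intro immersion.intro F.wf_digraph wf_hat_graph E.wf_digraph hom)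
qed

lemma T_rep_morphism:
  assumes "weighted_digraph E w" "(G, \<psi>) \<in> RG E w" "v \<in> verts G"
  shows "\<exists>\<alpha>. RG_morphism E w (T_rep E w (G, \<psi>) v) (G, \<psi>) \<alpha>"
proof -
  have rep: "is_rep_graph E w (G, \<psi>)" using assms(2) by (simp add: RG_def)
  interpret immersion G "hat_graph E w" \<psi>
    by (rule is_rep_graph_immersion[OF assms(1) rep])
  interpret pointed_immersion G "hat_graph E w" \<psi> v
    by unfold_locales fact
  have verts: "fst (T_map E w) p = fst \<psi> (fst cover p)" if "p \<in> verts T" for p
    using path_end_cover[OF that] by (simp add: T_map_def)
  have arcs: "snd (T_map E w) p = snd \<psi> (snd cover p)" if "p \<in> arcs T" for p
    using last_arc_cover[OF that] by (simp add: T_map_def)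
  have "is_rep_graph E w (T, T_map E w)"
    using wf_T covering_cover rep verts arcs by (rule is_rep_graph_covering)
  then have "(T, T_map E w) \<in> RG E w"
    using root_in_T connected_T by (auto simp: RG_def)
  then have "RG_morphism E w (T, T_map E w) (G, \<psi>) cover"
    using assms(2) cover_hom verts arcs by (auto simp: RG_morphism_def)
  then show ?thesis unfolding T_rep_def by blast
qed

lemma path_image_paths_from_iff:
  "(a, ds) \<in> path_image \<phi> ` paths_from (double_graph F) u \<longleftrightarrow>
   a = fst \<phi> u \<and> (\<exists>p v. dwalk F u p v \<and> ds = map (map_darc (snd \<phi>)) p)"
  by (auto simp: paths_from_def path_image_def image_iff)

lemma path_images_eqD:
  assumes eq: "path_image \<phi> ` paths_from (double_graph F) u = path_image \<psi> ` paths_from (double_graph G) v"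
    and p: "dwalk F u p x"
  obtains q y where "dwalk G v q y" "map (map_darc (snd \<phi>)) p = map (map_darc (snd \<psi>)) q"
    "fst \<phi> u = fst \<psi> v"
proof -
  have "(fst \<phi> u, map (map_darc (snd \<phi>)) p) \<in> path_image \<phi> ` paths_from (double_graph F) u"
    using p by (auto simp: path_image_paths_from_iff)
  then show thesis using that by (auto simp: eq path_image_paths_from_iff)
qed

text \<open>If \<open>r\<close> starts at \<open>u'\<close>, then the image of \<open>p @ r\<close> is also the image of a walk of \<open>G\<close> from
  \<open>v\<close>. By unique lifting that walk begins with \<open>q\<close>, so its remainder starts at \<open>v'\<close> and has the
  same image as \<open>r\<close>.\<close>

lemma path_images_translate:
  assumes "immersion F H \<phi>" "immersion G H \<psi>"
    and eq: "path_image \<phi> ` paths_from (double_graph F) u = path_image \<psi> ` paths_from (double_graph G) v"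
    and p: "dwalk F u p u'" and q: "dwalk G v q v'"
    and pq: "map (map_darc (snd \<phi>)) p = map (map_darc (snd \<psi>)) q"
  shows "path_image \<phi> ` paths_from (double_graph F) u' \<subseteq> path_image \<psi> ` paths_from (double_graph G) v'"
proof
  interpret F: immersion F H \<phi> by fact
  interpret G: immersion G H \<psi> by fact
  have start: "fst \<phi> u = fst \<psi> v"
    by (rule path_images_eqD[OF eq p])
  fix c assume "c \<in> path_image \<phi> ` paths_from (double_graph F) u'"
  then obtain r x where c: "c = (fst \<phi> u', map (map_darc (snd \<phi>)) r)" and r: "dwalk F u' r x"
    by (cases c) (auto simp: path_image_paths_from_iff)
  obtain s y where
    s: "dwalk G v s y" "map (map_darc (snd \<phi>)) (p @ r) = map (map_darc (snd \<psi>)) s"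
    by (rule path_images_eqD[OF eq F.D.awalk_appendI[OF p r]]) (rule that)
  then have "map (map_darc (snd \<psi>)) s = map (map_darc (snd \<psi>)) q @ map (map_darc (snd \<phi>)) r"
    by (simp add: pq)
  then obtain s1 s2 where s12: "s = s1 @ s2" "map (map_darc (snd \<psi>)) s1 = map (map_darc (snd \<psi>)) q"
    "map (map_darc (snd \<psi>)) s2 = map (map_darc (snd \<phi>)) r"
    by (auto simp: map_eq_append_conv)
  then obtain z where z: "dwalk G v s1 z" "dwalk G z s2 y"
    using s(1) by (auto simp: G.D.awalk_append_ex simp del: G.D.awalk_append_iff)
  have "s1 = q" using G.lift_unique[OF z(1) q s12(2)] .
  then have "z = v'"
    using path_end_awalk[OF G.D.wf_digraph z(1)] path_end_awalk[OF G.D.wf_digraph q] by simp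
  have "fst \<phi> u' = fst \<psi> v'"
    using path_end_awalk[OF wf_double_graph[OF F.wf_H] F.dwalk_image[OF p]]
      path_end_awalk[OF wf_double_graph[OF F.wf_H] G.dwalk_image[OF q]] pq start by simp
  moreover have "dwalk G v' s2 y" using z(2) \<open>z = v'\<close> by simp
  ultimately show "c \<in> path_image \<psi> ` paths_from (double_graph G) v'"
    unfolding c path_image_paths_from_iff using s12(3)
    by (intro conjI exI[of _ s2] exI[of _ y]) simp_all
qed

text \<open>The relation asks for one pair of base points only. Connectedness carries the first to any
  vertex \<open>u'\<close> by a walk, and a walk of \<open>G\<close> with the same image leads to the partner of \<open>u'\<close>.
  This also yields transitivity of the relation, since a common base point can be chosen in the
  middle graph.\<close>

lemma RG_equiv_any_base:
  assumes "weighted_digraph E w" "((F, \<phi>), (G, \<psi>)) \<in> RG_equiv E w" "u' \<in> verts F"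
  shows "\<exists>v' \<in> verts G. path_image \<phi> ` paths_from (double_graph F) u' =
                        path_image \<psi> ` paths_from (double_graph G) v'"
proof -
  from assms(2) obtain u v where uv: "u \<in> verts F" "v \<in> verts G"
    and eq: "path_image \<phi> ` paths_from (double_graph F) u = path_image \<psi> ` paths_from (double_graph G) v"
    and RG: "(F, \<phi>) \<in> RG E w" "(G, \<psi>) \<in> RG E w"
    by (auto simp: RG_equiv_def)
  then have imm: "immersion F (hat_graph E w) \<phi>" "immersion G (hat_graph E w) \<psi>"
    by (auto simp: RG_def intro: is_rep_graph_immersion[OF assms(1)])
  interpret G: immersion G "hat_graph E w" \<psi> by (rule imm)
  obtain p where p: "dwalk F u p u'"
    using RG(1) uv(1) assms(3) by (auto simp: RG_def double_connected_def)
  obtain q v' where q: "dwalk G v q v'" "map (map_darc (snd \<phi>)) p = map (map_darc (snd \<psi>)) q"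
    by (rule path_images_eqD[OF eq p]) (rule that)
  have "v' \<in> verts G" using G.D.awalk_last_in_verts[OF q(1)] by simp
  moreover have "path_image \<phi> ` paths_from (double_graph F) u' = path_image \<psi> ` paths_from (double_graph G) v'"
    using path_images_translate[OF imm eq p q]
      path_images_translate[OF imm(2,1) eq[symmetric] q(1) p q(2)[symmetric]] by (rule equalityI)
  ultimately show ?thesis by blast
qed

lemma RG_equiv_sym:
  assumes "((F, \<phi>), (G, \<psi>)) \<in> RG_equiv E w"
  shows "((G, \<psi>), (F, \<phi>)) \<in> RG_equiv E w"
proof -
  from assms obtain u v where "u \<in> verts F" "v \<in> verts G"
    "path_image \<phi> ` paths_from (double_graph F) u = path_image \<psi> ` paths_from (double_graph G) v"
    "(F, \<phi>) \<in> RG E w" "(G, \<psi>) \<in> RG E w"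
    by (auto simp: RG_equiv_def)
  then show ?thesis unfolding RG_equiv_def by (simp, intro bexI[of _ v] bexI[of _ u]) simp_all
qed

lemma T_graph_cong:
  assumes eq: "path_image \<phi> ` paths_from (double_graph F) u = path_image \<psi> ` paths_from (double_graph G) v"
    and "u \<in> verts F"
  shows "T_graph (F, \<phi>) u = T_graph (G, \<psi>) v"
proof -
  have "dwalk F u [] u" using assms(2) by (simp add: pre_digraph.awalk_def pre_digraph.cas.simps)
  then have "fst \<phi> u = fst \<psi> v" by (rule path_images_eqD[OF eq])
  then show ?thesis by (simp add: T_graph_def reduced_images_def eq)
qed

theorem proposition14:
  fixes E :: "('a, 'b) pre_digraph" and w :: "'b \<Rightarrow> nat"
    and C :: "('a, 'b, 'v, 'e) rep_graph set"
    and F G :: "('v, 'e) pre_digraph"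
    and \<phi> \<psi> :: "('v \<Rightarrow> 'a) \<times> ('e \<Rightarrow> 'b \<times> nat)"
    and u :: 'v
  assumes "weighted_digraph E w"
    and "C \<in> RG E w // RG_equiv E w"
    and "(F, \<phi>) \<in> C"
    and "u \<in> verts F"
    and "(G, \<psi>) \<in> C"
  shows "\<exists>\<alpha>. RG_morphism E w (T_rep E w (F, \<phi>) u) (G, \<psi>) \<alpha>"
proof -
  from assms(2) obtain X :: "('a, 'b, 'v, 'e) rep_graph"
    where C: "C = RG_equiv E w `` {X}" by (rule quotientE) (rule that)
  obtain K \<chi> where X: "X = (K, \<chi>)" by (cases X)
  from assms(3) have FX: "((F, \<phi>), (K, \<chi>)) \<in> RG_equiv E w"
    unfolding C X Image_singleton_iff by (rule RG_equiv_sym)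
  from assms(5) have XG: "((K, \<chi>), (G, \<psi>)) \<in> RG_equiv E w"
    unfolding C X Image_singleton_iff .
  obtain x where "x \<in> verts K" and x: "path_image \<phi> ` paths_from (double_graph F) u =
      path_image \<chi> ` paths_from (double_graph K) x"
    using RG_equiv_any_base[OF assms(1) FX assms(4)] by blast
  obtain v where v: "v \<in> verts G" and "path_image \<chi> ` paths_from (double_graph K) x =
      path_image \<psi> ` paths_from (double_graph G) v"
    using RG_equiv_any_base[OF assms(1) XG \<open>x \<in> verts K\<close>] by blast
  with x have "path_image \<phi> ` paths_from (double_graph F) u =
      path_image \<psi> ` paths_from (double_graph G) v" by simp
  then have "T_rep E w (F, \<phi>) u = T_rep E w (G, \<psi>) v"
    using T_graph_cong assms(4) by (simp add: T_rep_def)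
  moreover have "(G, \<psi>) \<in> RG E w" using XG by (auto simp: RG_equiv_def)
  ultimately show ?thesis using T_rep_morphism[OF assms(1) _ v] by simp
qed

end
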